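(* Let $p$ be an odd prime, $1\le m\le n$, and let $I=A\cup B$ be a generalized order ideal of $\mathbb{GH}(m,n)$, of saturated or unsaturated type, all of whose multiplicities lie in $\{0,p-1\}$, where $A$ is the part of $I$ on $[m]$ and $B$ the part of $I$ on $[n]\setminus[m]$, with supports $\bar A\subseteq[m]$ and $\bar B\subseteq[n]\setminus[m]$. Let $f:\mathbb{F}_p^n\to\mathbb{F}_p$ be the characteristic function of $I(\mathbb{GP})\setminus\{0\}$ and \[ \mathcal{C}_f=\{(sf(x)+u\cdot x)_{x\in\mathbb{F}_p^n\setminus0}:\ s\in\mathbb{F}_p,\ u\in\mathbb{F}_p^n\}. \] If $\bar A\cup\bar B\ne[n]$, then $\mathcal{C}_f$ is not minimal.
   Context: $[n]=\{1,\dots,n\}$; $u\cdot x=\sum_i u_ix_i$. The support $\mathrm{supp}(c)$ of a codeword $c$ is the set of positions where it is nonzero. A nonzero codeword $c$ of a linear code $\mathcal{C}$ over $\mathbb{F}_p$ is minimal if $c'\in\mathcal{C}$ and $\mathrm{supp}(c')\subseteq\mathrm{supp}(c)$ imply $c'\in\mathbb{F}_pc$; $\mathcal{C}$ is minimal if all its nonzero codewords are. Generalized order ideals: $[n]_{p-1}$ is the multiset in which each $i\in[n]$ has multiplicity $p-1$. A sub-multiset $J$ is identified with its multiplicity vector $(J_1,\dots,J_n)\in\{0,\dots,p-1\}^n$, regarded as a vector of $\mathbb{F}_p^n$; $J\subseteq J'$ means $J_i\le J'_i$ (as integers) for all $i$; $\bar J=\{i:J_i\ne0\}$. The hierarchical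 poset $\mathbb{H}(m,n)$ on $[n]$ has as its only strict relations $i\prec j$ for all $i\in[m]$, $j\in[n]\setminus[m]$; $\mathbb{GH}(m,n)$ denotes $[n]_{p-1}$ together with this order. $J$ is an unsaturated generalized order ideal if $\bar J$ is an order ideal (down-closed subset) of $\mathbb{H}(m,n)$; it is a saturated generalized order ideal if moreover $J_i=p-1$ whenever $j\in\bar J$ and $i\prec j$. For a generalized order ideal $I$ of either type, $I(\mathbb{GP})\subseteq\mathbb{F}_p^n$ is the set of all generalized order ideals of the same type contained in $I$.
   Formalization: The ideal I is assumed nonempty; for I empty the function f is zero and C_f = {(u·x)_x} is minimal, so the claim as stated fails in that case. *)

theory Defs
  imports
    "HOL-Library.FuncSet"
    "HOL-Library.Multiset"
    "HOL-Library.Indicator_Function"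
    "Berlekamp_Zassenhaus.Finite_Field"
begin

section \<open>Vectors\<close>

text \<open>
  A vector of length \<open>n\<close> over \<open>'a\<close> is an extensional function on \<open>{1..n}\<close>.  The prime field with
  \<open>p\<close> elements is \<open>'p mod_ring\<close> with \<open>'p :: prime_card\<close> and \<open>p = CARD('p)\<close>.
\<close>

definition vectors :: "nat \<Rightarrow> (nat \<Rightarrow> 'a) set" where
  "vectors n = {1..n} \<rightarrow>\<^sub>E UNIV"

definition null_vector :: "nat \<Rightarrow> nat \<Rightarrow> 'a :: zero" where
  "null_vector n = (\<lambda>i\<in>{1..n}. 0)"

definition dot :: "nat \<Rightarrow> (nat \<Rightarrow> 'a) \<Rightarrow> (nat \<Rightarrow> 'a) \<Rightarrow> 'a :: comm_semiring_0" where
  "dot n u x = (\<Sum>i\<in>{1..n}. u i * x i)"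


section \<open>Minimal codes\<close>

text \<open>
  The positions of a code form an arbitrary set \<open>X\<close>, and codewords are extensional functions on
  \<open>X\<close>.
\<close>

definition linear_code :: "'x set \<Rightarrow> ('x \<Rightarrow> 'a :: field) set \<Rightarrow> bool" where
  "linear_code X C \<longleftrightarrow>
     C \<subseteq> X \<rightarrow>\<^sub>E UNIV \<and>
     (\<lambda>x\<in>X. 0) \<in> C \<and>
     (\<forall>c\<in>C. \<forall>c'\<in>C. (\<lambda>x\<in>X. c x + c' x) \<in> C) \<and>
     (\<forall>a. \<forall>c\<in>C. (\<lambda>x\<in>X. a * c x) \<in> C)"

definition supp :: "'x set \<Rightarrow> ('x \<Rightarrow> 'a :: zero) \<Rightarrow> 'x set" where
  "supp X c = {x \<in> X. c x \<noteq> 0}"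

definition minimal_codeword ::
  "'x set \<Rightarrow> ('x \<Rightarrow> 'a :: field) set \<Rightarrow> ('x \<Rightarrow> 'a) \<Rightarrow> bool" where
  "minimal_codeword X C c \<longleftrightarrow>
     c \<in> C \<and> c \<noteq> (\<lambda>x\<in>X. 0) \<and>
     (\<forall>c'\<in>C. supp X c' \<subseteq> supp X c \<longrightarrow> (\<exists>a. c' = (\<lambda>x\<in>X. a * c x)))"

definition minimal_code :: "'x set \<Rightarrow> ('x \<Rightarrow> 'a :: field) set \<Rightarrow> bool" where
  "minimal_code X C \<longleftrightarrow> (\<forall>c\<in>C. c \<noteq> (\<lambda>x\<in>X. 0) \<longrightarrow> minimal_codeword X C c)"

definition code_of :: "nat \<Rightarrow> ((nat \<Rightarrow> 'a) \<Rightarrow> 'a :: field) \<Rightarrow> ((nat \<Rightarrow> 'a) \<Rightarrow> 'a) set" where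
  "code_of n f =
     {(\<lambda>x \<in> vectors n - {null_vector n}. s * f x + dot n u x) | s u. u \<in> vectors n}"

lemma linear_code_code_of: "linear_code (vectors n - {null_vector n}) (code_of n f)"
  unfolding linear_code_def
proof (intro conjI ballI allI)
  let ?X = "vectors n - {null_vector n :: nat \<Rightarrow> 'a}"
  have dot_cong: "dot n (restrict u {1..n}) x = (\<Sum>i\<in>{1..n}. u i * x i)" for u x :: "nat \<Rightarrow> 'a"
    unfolding dot_def by (intro sum.cong) auto
  have mem: "c \<in> code_of n f" if "c = (\<lambda>x\<in>?X. s * f x + (\<Sum>i\<in>{1..n}. u i * x i))" for c s u
    unfolding code_of_def that
    by (intro CollectI exI[of _ s] exI[of _ "restrict u {1..n}"])
       (simp only: dot_cong, simp add: vectors_def)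
  show "code_of n f \<subseteq> ?X \<rightarrow>\<^sub>E UNIV"
    unfolding code_of_def by (auto intro!: restrict_PiE_iff[THEN iffD2])
  show "(\<lambda>x\<in>?X. 0) \<in> code_of n f"
    by (rule mem[of _ 0 "\<lambda>_. 0"]) simp
  fix c assume "c \<in> code_of n f"
  then obtain s u where c: "c = (\<lambda>x\<in>?X. s * f x + dot n u x)"
    by (auto simp: code_of_def)
  {
    fix c' assume "c' \<in> code_of n f"
    then obtain t v where c': "c' = (\<lambda>x\<in>?X. t * f x + dot n v x)"
      by (auto simp: code_of_def)
    show "(\<lambda>x\<in>?X. c x + c' x) \<in> code_of n f"
      by (rule mem[of _ "s + t" "\<lambda>i. u i + v i"], rule restrict_ext)
         (simp add: c c' dot_def algebra_simps sum.distrib)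
  }
  show "(\<lambda>x\<in>?X. a * c x) \<in> code_of n f" for a
    by (rule mem[of _ "a * s" "\<lambda>i. a * u i"], rule restrict_ext)
       (simp add: c dot_def algebra_simps sum_distrib_left)
qed


section \<open>Generalized order ideals of hierarchical posets\<close>

definition hier_less :: "nat \<Rightarrow> nat \<Rightarrow> nat \<Rightarrow> nat \<Rightarrow> bool" where
  "hier_less m n i j \<longleftrightarrow> i \<in> {1..m} \<and> j \<in> {1..n} - {1..m}"

definition order_ideal :: "nat \<Rightarrow> nat \<Rightarrow> nat set \<Rightarrow> bool" where
  "order_ideal m n D \<longleftrightarrow> D \<subseteq> {1..n} \<and> (\<forall>j\<in>D. \<forall>i\<in>{1..n}. hier_less m n i j \<longrightarrow> i \<in> D)"

text \<open>The multiset in which each element of \<open>{1..n}\<close> has multiplicity \<open>p - 1\<close>.\<close>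

definition ground_mset :: "nat \<Rightarrow> nat \<Rightarrow> nat multiset" where
  "ground_mset p n = (\<Sum>i\<in>{1..n}. replicate_mset (p - 1) i)"

datatype ideal_type = Unsaturated | Saturated

fun gen_order_ideal ::
  "ideal_type \<Rightarrow> nat \<Rightarrow> nat \<Rightarrow> nat \<Rightarrow> nat multiset \<Rightarrow> bool" where
  "gen_order_ideal Unsaturated p m n J \<longleftrightarrow>
     J \<subseteq># ground_mset p n \<and> order_ideal m n (set_mset J)"
| "gen_order_ideal Saturated p m n J \<longleftrightarrow>
     J \<subseteq># ground_mset p n \<and> order_ideal m n (set_mset J) \<and>
     (\<forall>j \<in> set_mset J. \<forall>i. hier_less m n i j \<longrightarrow> count J i = p - 1)"

text \<open>
  The multiplicity vector of a multiset, read in the coefficient field.  For \<open>'a = 'p mod_ring\<close>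
  with \<open>CARD('p) = p\<close> it is a bijection from the submultisets of \<^term>\<open>ground_mset p n\<close> onto
  \<^term>\<open>vectors n\<close>.
\<close>

definition mult_vector :: "nat \<Rightarrow> nat multiset \<Rightarrow> nat \<Rightarrow> 'a :: semiring_1" where
  "mult_vector n J = (\<lambda>i\<in>{1..n}. of_nat (count J i))"

definition ideals_within ::
  "ideal_type \<Rightarrow> nat \<Rightarrow> nat \<Rightarrow> nat \<Rightarrow> nat multiset \<Rightarrow> (nat \<Rightarrow> 'a :: semiring_1) set" where
  "ideals_within T p m n I = mult_vector n ` {J. gen_order_ideal T p m n J \<and> J \<subseteq># I}"

end

theory Submission
  imports Defs
begin

text \<open>
  Some coordinate \<open>j\<close> has multiplicity zero in \<open>I\<close>, so every vector of \<open>I(GP)\<close> vanishes at \<open>j\<close>.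
  Hence the codeword of \<open>f(x) + x\<^sub>j\<close> never cancels: its support is the disjoint union of the
  supports of \<open>f\<close> and of \<open>x\<^sub>j\<close>.  Both of these are nonempty, since \<open>f\<close> is nonzero at the multiplicity
  vector of \<open>I\<close> and \<open>x\<^sub>j\<close> is nonzero at the \<open>j\<close>-th unit vector.  The codeword of \<open>x\<^sub>j\<close> therefore has
  strictly smaller nonempty support, and \<open>f(x) + x\<^sub>j\<close> is not minimal.
\<close>

lemma dot_unit_vector:
  fixes x :: "nat \<Rightarrow> 'a :: comm_semiring_1"
  assumes "j \<in> {1..n}"
  shows "dot n (\<lambda>i\<in>{1..n}. if i = j then 1 else 0) x = x j"
proof -
  have "dot n (\<lambda>i\<in>{1..n}. if i = j then 1 else 0) x = (\<Sum>i\<in>{1..n}. if i = j then x i else 0)"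
    unfolding dot_def by (intro sum.cong) auto
  then show ?thesis using assms by simp
qed

text \<open>
  The obstruction to minimality holds for any function \<open>f\<close>, not identically zero away from the
  origin, that is supported in a coordinate hyperplane.
\<close>

lemma not_minimal_code_of_if_supp_in_hyperplane:
  fixes f :: "(nat \<Rightarrow> 'a) \<Rightarrow> 'a :: field"
  assumes j: "j \<in> {1..n}"
    and supp_f: "\<And>x. f x \<noteq> 0 \<Longrightarrow> x j = 0"
    and y: "y \<in> vectors n - {null_vector n}" "f y \<noteq> 0"
  shows "\<not> minimal_code (vectors n - {null_vector n}) (code_of n f)"
proof
  let ?X = "vectors n - {null_vector n :: nat \<Rightarrow> 'a}"
  define e :: "nat \<Rightarrow> 'a" where "e = (\<lambda>i\<in>{1..n}. if i = j then 1 else 0)"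
  assume minimal: "minimal_code ?X (code_of n f)"
  have e_vec: "e \<in> vectors n" by (simp add: e_def vectors_def)
  have dot_e: "dot n e x = x j" for x
    unfolding e_def by (rule dot_unit_vector[OF j])
  have ej: "e j = 1" using j by (simp add: e_def)
  have "e \<noteq> null_vector n"
    using ej j by (metis null_vector_def restrict_apply' zero_neq_one)
  then have eX: "e \<in> ?X" using e_vec by simp
  have fe: "f e = 0" using supp_f[of e] ej by auto
  have yj: "y j = 0" using supp_f y(2) by blast
  define c c' where "c = (\<lambda>x\<in>?X. f x + x j)" and "c' = (\<lambda>x\<in>?X. x j)"
  have c: "c \<in> code_of n f"
    unfolding code_of_def c_def using e_vec by (force simp: dot_e intro: exI[of _ 1] exI[of _ e])
  have c': "c' \<in> code_of n f"
    unfolding code_of_def c'_def using e_vec by (force simp: dot_e intro: exI[of _ 0] exI[of _ e])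
  have "c e = 1" using eX fe ej by (simp add: c_def)
  then have "c \<noteq> (\<lambda>x\<in>?X. 0)" using eX by auto
  moreover have "supp ?X c' \<subseteq> supp ?X c"
  proof
    fix x assume "x \<in> supp ?X c'"
    then have x: "x \<in> ?X" "x j \<noteq> 0" by (auto simp: supp_def c'_def)
    then have "f x = 0" using supp_f by blast
    then show "x \<in> supp ?X c" using x by (simp add: supp_def c_def)
  qed
  ultimately obtain a where a: "c' = (\<lambda>x\<in>?X. a * c x)"
    using minimal c c' unfolding minimal_code_def minimal_codeword_def by blast
  have "a * f y = 0" using fun_cong[OF a, of y] y(1) yj by (simp add: c_def c'_def)
  moreover have "a = 1" using fun_cong[OF a, of e] eX ej fe by (simp add: c_def c'_def)
  ultimately show False using y(2) by simp
qed

lemma count_ground_mset: "count (ground_mset p n) i = (if i \<in> {1..n} then p - 1 else 0)"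
  by (simp add: ground_mset_def count_sum)

lemma gen_order_ideal_subset_ground_mset:
  "gen_order_ideal T p m n J \<Longrightarrow> J \<subseteq># ground_mset p n"
  by (cases T) auto

lemma mult_vector_in_vectors: "mult_vector n J \<in> vectors n"
  by (simp add: mult_vector_def vectors_def)

text \<open>The multiplicities lie below the characteristic, so none of them vanishes in the field.\<close>

lemma mult_vector_neq_null_vector:
  assumes "J \<subseteq># ground_mset CARD('p :: prime_card) n" and "J \<noteq> {#}"
  shows "(mult_vector n J :: nat \<Rightarrow> 'p mod_ring) \<noteq> null_vector n"
proof
  assume eq: "(mult_vector n J :: nat \<Rightarrow> 'p mod_ring) = null_vector n"
  obtain i where i: "i \<in># J" using assms(2) by blast
  have le: "count J i \<le> count (ground_mset CARD('p) n) i"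
    using assms(1) by (rule mset_subset_eq_count)
  have pos: "count J i > 0" using i by (simp only: count_greater_zero_iff)
  have in_range: "i \<in> {1..n}"
    using le pos by (metis count_ground_mset not_le)
  then have "count J i \<le> CARD('p) - 1" using le by (simp add: count_ground_mset)
  then have less: "count J i < CARD('p)" using pos by linarith
  have "(of_nat (count J i) :: 'p mod_ring) = 0"
    using fun_cong[OF eq, of i] in_range by (simp add: mult_vector_def null_vector_def)
  then have "CARD('p) dvd count J i" by (simp add: of_nat_0_mod_ring_dvd)
  then show False using less pos by (auto dest: dvd_imp_le)
qed

theorem proposition5p2:
  fixes p m n :: nat
    and T :: ideal_type
    and I A B :: "nat multiset"
    and f :: "(nat \<Rightarrow> 'p :: prime_card mod_ring) \<Rightarrow> 'p mod_ring"
  assumes "p = CARD('p)" and "odd p"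
    and "1 \<le> m" and "m \<le> n"
    and "gen_order_ideal T p m n I"
    and "\<forall>i\<in>{1..n}. count I i \<in> {0, p - 1}"
    and "I \<noteq> {#}"
    and "I = A \<union># B" and "set_mset A \<subseteq> {1..m}" and "set_mset B \<subseteq> {1..n} - {1..m}"
    and "f = indicator (ideals_within T p m n I - {null_vector n})"
    and "set_mset A \<union> set_mset B \<noteq> {1..n}"
  shows "\<not> minimal_code (vectors n - {null_vector n}) (code_of n f)"
proof -
  have "set_mset I = set_mset A \<union> set_mset B" by (simp add: assms(8))
  moreover have "set_mset A \<union> set_mset B \<subseteq> {1..n}" using assms(4,9,10) by fastforce
  ultimately obtain j where j: "j \<in> {1..n}" "j \<notin># I"
    using assms(12) by blast
  have "x j = 0" if "f x \<noteq> 0" for x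
  proof -
    have "x \<in> ideals_within T p m n I"
      using that assms(11) by (auto simp: indicator_def split: if_splits)
    then obtain J where J: "J \<subseteq># I" "x = mult_vector n J"
      by (auto simp: ideals_within_def)
    have "count J j = 0" using J(1) j(2) by (meson mset_subset_eqD not_in_iff)
    then show "x j = 0" using J(2) j(1) by (simp add: mult_vector_def)
  qed
  moreover have nonnull: "(mult_vector n I :: nat \<Rightarrow> 'p mod_ring) \<noteq> null_vector n"
    using mult_vector_neq_null_vector gen_order_ideal_subset_ground_mset[OF assms(5)] assms(1,7)
    by blast
  moreover have "f (mult_vector n I) \<noteq> 0"
    using nonnull assms(5) by (auto simp: assms(11) ideals_within_def)
  ultimately show ?thesis
    using not_minimal_code_of_if_supp_in_hyperplane[OF j(1), of f "mult_vector n I"]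
    by (simp add: mult_vector_in_vectors)
qed

end
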